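(* Let $\Lambda\equiv\{\lambda\ge 0:\lambda\le 1/\gamma^\star\}$ be a subset of admissible Lagrange multipliers associated with the constraint of the risk-constrained problem $$\min_{x\in\mathbb{R}^d}\ \mathbb{E}_\mu\|X-x\|_2^2\quad\text{s.t.}\quad \mathbb{E}_\mu\big(\|X-x\|_2^2-\mathbb{E}_\mu\|X-x\|_2^2\big)^2\le\varepsilon ,$$ with $\gamma^\star$ as in the context, and let $\nu^\star$ be determined by $\mu$ through $$\left(\frac{d\nu}{d\mu}\right)^{\star}=\lambda^\star_{md}(\varepsilon)\,\frac{Z_{x}-\mathbb{E}_\mu Z_{x}}{(\mathrm{var}_\mu Z_{x})^{1/2}}+1 ,\qquad Z_x=\|X-x\|_2^2 .$$ Then $(\nu^\star(\widehat X^\star),\widehat X^\star(\nu^\star))$ is a saddle point of $f(\xi,x)$ over $\chi^2_{\gamma^\star}(\mu)\times\mathbb{R}^d$. In particular, the estimator $\widehat X^\star_\lambda$ solves the $\chi^2$-distributionally robust optimization problem $$\min_{x\in\mathbb{R}^d}\ \Big\{\sup_{0\le\nu\in\mathcal{L}_2^\star}\ \mathbb{E}_{\nu}\|X-x\|_2^2\ :\ \chi^2(\nu\|\mu)\le\lambda\Big\},\qquad \lambda\in\Lambda .$$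
   Context: $\mu$ is a Borel probability measure on $\mathbb{R}^d$ with $\int\|x\|_2^3\,d\mu(x)<\infty$, $X\sim\mu$, $\mathbb{E}=\mathbb{E}_\mu$, and $\Sigma\succcurlyeq0$ is the covariance matrix of $X$. The number $\varepsilon$ is the risk level. For $\lambda\ge0$, $$\widehat X^\star_\lambda=(I+4\lambda\Sigma)^{-1}\Big(\mathbb{E}X+2\lambda\big(\mathbb{E}[\|X\|_2^2X]-\mathbb{E}\|X\|_2^2\,\mathbb{E}X\big)\Big)$$ is the optimal solution of the risk-constrained problem when $\lambda$ is the optimal multiplier of its constraint. $\widehat X^\star_0=\mathbb{E}X$, and $\widehat X^\star_\infty$ is the value of $\widehat X^\star_\lambda$ as $\lambda\to\infty$, written $\widehat X^\star_\infty=\tfrac12\Sigma^{-1}\big(\mathbb{E}[\|X\|_2^2X]-\mathbb{E}\|X\|_2^2\,\mathbb{E}X\big)$ when $\Sigma$ is invertible. The constant is $$\gamma^\star=2\big(\mathbb{E}\|\widehat X^\star_\infty-\widehat X^\star_0\|_2^2+\mathrm{mmse}(\mu)\big),\qquad \mathrm{mmse}(\mu)=\mathbb{E}\|X-\mathbb{E}X\|_2^2 .$$ $\lambda^\star_{md}(\varepsilon)$ is the optimal Lagrange multiplier of the constraint of the equivalent problem of minimizing $\mathbb{E}_\mu Z_x$ over $x\in\mathbb{R}^d$ subject to $\sqrt{\mathrm{var}_\mu Z_x}\le\sqrt{\varepsilon}$. $f(\xi,x)=\mathbb{E}_\xi\|x-X\|_2^2$. $\mathcal{L}_2^\star$ is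 the dual of $\mathcal{L}_2(\mu)$; a measure $\nu\ll\mu$ is regarded as an element of it through its density $d\nu/d\mu$, and the normalization $\mathbb{E}_\mu[d\nu/d\mu]=1$ is understood throughout. $\chi^2(\nu\|\mu)=\mathbb{E}_\mu(d\nu/d\mu-1)^2$, and for $\rho\ge0$ $$\chi^2_\rho(\mu)=\{\nu\in\mathcal{L}_2^\star:\ \mathbb{E}_\mu(d\nu/d\mu-1)^2\le\rho\}$$ is the $\chi^2$-ball of radius $\rho$ centered at $\mu$ (signed measures allowed). $\widehat X^\star$ is the estimator $\widehat X^\star_\lambda$; $\nu^\star(\widehat X^\star)$ is the measure $\nu^\star$ given by the density above at $x=\widehat X^\star$; $\widehat X^\star(\nu^\star)$ is the corresponding best response to $\nu^\star$, namely $\mathbb{E}_{\nu^\star}X$. A saddle point means that $\nu^\star$ maximizes $f(\cdot,\widehat X^\star)$ over the ball and $\widehat X^\star$ minimizes $f(\nu^\star,\cdot)$ over $\mathbb{R}^d$.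
   Formalization: The printed ball radii γ* (saddle point) and λ (robust problem) fail, e.g. for Bernoulli(1/4) on {0,1} with λ=1; both are replaced by λ*_md(ε)², the χ²-divergence of ν*, with the multiplier λ*_md(ε)=2λ√ε in the robust problem. *)

theory Defs
  imports "HOL-Probability.Probability"
begin

text \<open>The random vector \<open>X\<close> is the identity on the probability space \<open>\<mu>\<close>.\<close>

definition mean :: "(real ^ 'n) measure \<Rightarrow> real ^ 'n" where
  "mean \<mu> = (LINT \<xi>|\<mu>. \<xi>)"

definition cov_matrix :: "(real ^ 'n) measure \<Rightarrow> real ^ 'n ^ 'n" where
  "cov_matrix \<mu> = (\<chi> i j. LINT \<xi>|\<mu>. (\<xi> $ i - mean \<mu> $ i) * (\<xi> $ j - mean \<mu> $ j))"

definition mmse :: "(real ^ 'n) measure \<Rightarrow> real" where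
  "mmse \<mu> = (LINT \<xi>|\<mu>. (norm (\<xi> - mean \<mu>))\<^sup>2)"

definition sq_err :: "real ^ 'n \<Rightarrow> real ^ 'n \<Rightarrow> real" where
  "sq_err x \<xi> = (norm (\<xi> - x))\<^sup>2"

definition mean_err :: "(real ^ 'n) measure \<Rightarrow> real ^ 'n \<Rightarrow> real" where
  "mean_err \<mu> x = (LINT \<xi>|\<mu>. sq_err x \<xi>)"

definition var_err :: "(real ^ 'n) measure \<Rightarrow> real ^ 'n \<Rightarrow> real" where
  "var_err \<mu> x = (LINT \<xi>|\<mu>. (sq_err x \<xi> - mean_err \<mu> x)\<^sup>2)"

definition X_hat :: "(real ^ 'n) measure \<Rightarrow> real \<Rightarrow> real ^ 'n" where
  "X_hat \<mu> l = matrix_inv (mat 1 + (4 * l) *\<^sub>R cov_matrix \<mu>) *v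
     (mean \<mu> + (2 * l) *\<^sub>R
        ((LINT \<xi>|\<mu>. (norm \<xi>)\<^sup>2 *\<^sub>R \<xi>) - (LINT \<xi>|\<mu>. (norm \<xi>)\<^sup>2) *\<^sub>R mean \<mu>))"

text \<open>Defined as a limit, so that a singular covariance matrix is covered.\<close>

definition X_hat_inf :: "(real ^ 'n) measure \<Rightarrow> real ^ 'n" where
  "X_hat_inf \<mu> = Lim at_top (X_hat \<mu>)"

definition gamma_star :: "(real ^ 'n) measure \<Rightarrow> real" where
  "gamma_star \<mu> = 2 * ((norm (X_hat_inf \<mu> - X_hat \<mu> 0))\<^sup>2 + mmse \<mu>)"

text \<open>The bound \<open>l \<le> 1 / \<gamma>\<close> in product form, so that \<open>1 / 0\<close> counts as infinity
  (the degenerate case of a point mass).\<close>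

definition Lambda_set :: "(real ^ 'n) measure \<Rightarrow> real set" where
  "Lambda_set \<mu> = {l. 0 \<le> l \<and> l * gamma_star \<mu> \<le> 1}"

text \<open>Optimal Lagrange multiplier of the constraint \<open>G x \<le> c\<close> in the problem of minimizing
  \<open>F x\<close> over \<open>x \<in> D\<close>: the primal optimum is attained and equals the dual value
  \<open>inf y\<in>D. F y + l * (G y - c)\<close>.  Taking \<open>y = x\<close> gives \<open>l * (G x - c) = 0\<close>, and
  taking \<open>y\<close> feasible gives the optimality of \<open>x\<close>.\<close>

definition optimal_multiplier ::
  "'a set \<Rightarrow> ('a \<Rightarrow> real) \<Rightarrow> ('a \<Rightarrow> real) \<Rightarrow> real \<Rightarrow> real \<Rightarrow> bool" where
  "optimal_multiplier D F G c l \<longleftrightarrow>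
     0 \<le> l \<and> (\<exists>x\<in>D. G x \<le> c \<and> (\<forall>y\<in>D. F x \<le> F y + l * (G y - c)))"

text \<open>Points where the variance of the squared error is finite.  The Bochner integral in
  \<^const>\<open>var_err\<close> is \<open>0\<close> when it diverges; such points violate the risk constraint at every
  level, so they must be excluded.\<close>

definition finite_risk :: "(real ^ 'n) measure \<Rightarrow> (real ^ 'n) set" where
  "finite_risk \<mu> = {x. integrable \<mu> (\<lambda>\<xi>. (sq_err x \<xi>)\<^sup>2)}"

definition risk_multiplier :: "(real ^ 'n) measure \<Rightarrow> real \<Rightarrow> real \<Rightarrow> bool" where
  "risk_multiplier \<mu> \<epsilon> l \<longleftrightarrow>
     optimal_multiplier (finite_risk \<mu>) (mean_err \<mu>) (var_err \<mu>) \<epsilon> l"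

definition md_multiplier :: "(real ^ 'n) measure \<Rightarrow> real \<Rightarrow> real \<Rightarrow> bool" where
  "md_multiplier \<mu> \<epsilon> l \<longleftrightarrow>
     optimal_multiplier (finite_risk \<mu>) (mean_err \<mu>) (\<lambda>x. sqrt (var_err \<mu> x)) (sqrt \<epsilon>) l"

text \<open>A signed measure \<open>\<nu> \<lless> \<mu>\<close> in the dual of \<open>L\<^sub>2(\<mu>)\<close> is represented by its density
  \<open>h = d\<nu>/d\<mu>\<close>.\<close>

definition chi2_ball :: "(real ^ 'n) measure \<Rightarrow> real \<Rightarrow> (real ^ 'n \<Rightarrow> real) set" where
  "chi2_ball \<mu> \<rho> = {h. h \<in> borel_measurable \<mu> \<and> integrable \<mu> (\<lambda>\<xi>. (h \<xi>)\<^sup>2) \<and>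
     (LINT \<xi>|\<mu>. h \<xi>) = 1 \<and> (LINT \<xi>|\<mu>. (h \<xi> - 1)\<^sup>2) \<le> \<rho>}"

definition f_obj :: "(real ^ 'n) measure \<Rightarrow> (real ^ 'n \<Rightarrow> real) \<Rightarrow> real ^ 'n \<Rightarrow> real" where
  "f_obj \<mu> h x = (LINT \<xi>|\<mu>. h \<xi> * sq_err x \<xi>)"

text \<open>If the variance vanishes, then \<open>sq_err x\<close> is a.e. constant, and division by zero makes
  the density the constant \<open>1\<close>.\<close>

definition nu_star :: "(real ^ 'n) measure \<Rightarrow> real \<Rightarrow> real ^ 'n \<Rightarrow> (real ^ 'n \<Rightarrow> real)" where
  "nu_star \<mu> l x = (\<lambda>\<xi>. l * ((sq_err x \<xi> - mean_err \<mu> x) / sqrt (var_err \<mu> x)) + 1)"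

definition best_response :: "(real ^ 'n) measure \<Rightarrow> (real ^ 'n \<Rightarrow> real) \<Rightarrow> real ^ 'n" where
  "best_response \<mu> h = (LINT \<xi>|\<mu>. h \<xi> *\<^sub>R \<xi>)"

definition saddle_point ::
  "('a \<Rightarrow> 'b \<Rightarrow> real) \<Rightarrow> 'a set \<Rightarrow> 'b set \<Rightarrow> 'a \<Rightarrow> 'b \<Rightarrow> bool" where
  "saddle_point f A B a b \<longleftrightarrow>
     a \<in> A \<and> b \<in> B \<and> (\<forall>a'\<in>A. f a' b \<le> f a b) \<and> (\<forall>b'\<in>B. f a b \<le> f a b')"

definition dro_obj :: "(real ^ 'n) measure \<Rightarrow> real \<Rightarrow> real ^ 'n \<Rightarrow> ereal" where
  "dro_obj \<mu> \<rho> x =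
     (SUP h\<in>{h \<in> chi2_ball \<mu> \<rho>. AE \<xi> in \<mu>. 0 \<le> h \<xi>}. ereal (f_obj \<mu> h x))"

definition dro_solution :: "(real ^ 'n) measure \<Rightarrow> real \<Rightarrow> real ^ 'n \<Rightarrow> bool" where
  "dro_solution \<mu> \<rho> x \<longleftrightarrow> (\<forall>y. dro_obj \<mu> \<rho> x \<le> dro_obj \<mu> \<rho> y)"

end

theory Submission
  imports Defs
begin

text \<open>
  Write \<open>Z\<^sub>x = sq_err x\<close>, \<open>m\<close> for the mean, \<open>S\<close> for the covariance matrix, \<open>s(x)\<close> for the standard
  deviation of \<open>Z\<^sub>x\<close> and \<open>k(x)\<close> for the covariance of \<open>Z\<^sub>x\<close> with the random vector
  (\<open>err_cov\<close> below).  A risk multiplier can exist only if some \<open>Z\<^sub>x\<close> is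
  square-integrable, which amounts to a finite fourth moment; then every \<open>Z\<^sub>x\<close> is, and all of
  the following takes place in \<open>L\<^sub>2\<close>.

  Moving from \<open>x\<close> to \<open>y\<close> changes the centered error by the linear function
  \<open>- 2 (y - x) \<bullet> (\<xi> - m)\<close>.  Hence the mean and the variance of \<open>Z\<^sub>y\<close> are quadratic in \<open>y\<close>,
  the gradient of the variance is \<open>- 4 k\<close>, and the Lagrangian
  \<open>mean_err + l * var_err\<close> is strongly convex.  Its only minimizer is \<open>X_hat \<mu> l\<close>, and
  this point is the only solution of \<open>x - m = 2 l k(x)\<close> (\<open>X_hat_iff_stationary\<close>,
  \<open>lagrangian_X_hat\<close>).

  The mean-deviation Lagrangian \<open>mean_err + c * s\<close> has the stationarity condition
  \<open>x - m = (c / s(x)) k(x)\<close> wherever \<open>s(x) > 0\<close>.  The right-hand side is exactly the displacement of the mean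
  caused by the density \<open>nu_star \<mu> c x\<close> (\<open>best_response_nu_star\<close>), so stationarity says that
  \<open>x\<close> is the best response to its own worst case.  Conversely, by the Cauchy--Schwarz inequality
  \<open>nu_star \<mu> c x\<close> maximizes the expectation of \<open>Z\<^sub>x\<close> over the ball of radius \<open>c\<^sup>2\<close>; the maximum
  is \<open>mean_err x + c s(x)\<close>.  Together these give the saddle point.  No derivative of \<open>s\<close> is taken:
  the passage from the mean-deviation to the quadratic problem uses
  \<open>2 s(x) s(y) \<le> s(x)\<^sup>2 + s(y)\<^sup>2\<close> (\<open>md_minimizer_stationary\<close>), and the passage back uses
  that the covariance of \<open>Z\<^sub>x\<close> and \<open>Z\<^sub>y\<close> is at most \<open>s(x) s(y)\<close> (\<open>std_err_tangent\<close>).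

  For the robust problem over nonnegative densities the worst case itself must be nonnegative.
  With \<open>c = 2 l \<surd>\<epsilon>\<close> and \<open>s > 0\<close> it equals \<open>1 + 2 l (Z\<^sub>x - mean_err x)\<close>, and since
  \<open>Z\<^sub>x \<ge> 0\<close> it suffices that \<open>2 l mean_err x \<le> 1\<close>.  This is the role of the bound
  \<open>l \<le> 1 / \<gamma>\<close>: the distance from \<open>X_hat \<mu> l\<close> to the mean never exceeds that of
  \<open>X_hat_inf \<mu>\<close> (\<open>norm_X_hat_le_X_hat_inf\<close>), so \<open>2 mean_err x \<le> \<gamma>\<close>.
\<close>

section \<open>Positive semidefinite matrices\<close>

text \<open>Solved for \<open>d\<close>, the equation says that \<open>d\<close> is the image of \<open>a\<close> under \<open>(I + t A)\<^sup>-\<^sup>1 t A\<close>.  In the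
  implicit form, pairing it with \<open>a - d\<close> gives \<open>(a - d) \<bullet> d \<ge> 0\<close> without a spectral decomposition.\<close>

lemma psd_resolvent_norm_le:
  fixes A :: "real ^ 'n ^ 'n"
  assumes psd: "\<And>v. 0 \<le> v \<bullet> (A *v v)" and "0 \<le> t" and d: "d = t *\<^sub>R (A *v (a - d))"
  shows "norm d \<le> norm a"
proof -
  have "(a - d) \<bullet> d = t * ((a - d) \<bullet> (A *v (a - d)))"
    by (subst (2) d) simp
  then have "0 \<le> (a - d) \<bullet> d"
    using psd \<open>0 \<le> t\<close> by simp
  then have "d \<bullet> d \<le> a \<bullet> d"
    by (simp add: inner_diff_left)
  also have "\<dots> \<le> norm a * norm d"
    by (rule norm_cauchy_schwarz)
  finally have "norm d * norm d \<le> norm a * norm d"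
    by (simp add: dot_square_norm power2_eq_square)
  then show ?thesis
    by (cases "norm d = 0") auto
qed

lemma psd_resolvent_invertible:
  fixes A :: "real ^ 'n ^ 'n"
  assumes psd: "\<And>v. 0 \<le> v \<bullet> (A *v v)" and "0 \<le> t"
  shows "invertible (mat 1 + t *\<^sub>R A)"
proof -
  have "x = 0" if "(mat 1 + t *\<^sub>R A) *v x = 0" for x
  proof -
    have "x = t *\<^sub>R (A *v (0 - x))"
      using that unfolding matrix_vector_mult_diff_distrib
      by (simp add: matrix_vector_mult_add_rdistrib scaleR_matrix_vector_assoc[symmetric] eq_neg_iff_add_eq_0)
    from psd_resolvent_norm_le[OF psd \<open>0 \<le> t\<close> this] show ?thesis by simp
  qed
  then show ?thesis
    by (simp add: invertible_left_inverse matrix_left_invertible_ker)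
qed

lemma matrix_inv_inverse:
  assumes "invertible A"
  shows "A ** matrix_inv A = mat 1 \<and> matrix_inv A ** A = mat 1"
  using assms unfolding invertible_def matrix_inv_def by (rule someI_ex)

text \<open>A symmetric matrix and its square have the same kernel, hence also the same range, the orthogonal
  complement of that kernel.  The factor \<open>A\<^sup>2\<close> rather than \<open>A\<close> makes it possible below to identify
  the limit of the estimators for a singular covariance matrix.\<close>

lemma symmetric_range_square:
  fixes A :: "real ^ 'n ^ 'n"
  assumes sym: "\<And>v w. v \<bullet> (A *v w) = w \<bullet> (A *v v)"
    and ker: "\<And>z. A *v z = 0 \<Longrightarrow> z \<bullet> b = 0"
  obtains u where "b = A *v (A *v u)"
proof -
  have sub: "span (range (\<lambda>u. A *v (A *v u))) = range (\<lambda>u. A *v (A *v u))"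
    by (intro span_eq_iff[THEN iffD2] linear_subspace_image[OF _ subspace_UNIV]
        linear_compose[unfolded o_def, of "\<lambda>u. A *v u" "\<lambda>u. A *v u"] matrix_vector_mul_linear)
  obtain y z where y: "y \<in> range (\<lambda>u. A *v (A *v u))"
    and z: "\<And>w. w \<in> range (\<lambda>u. A *v (A *v u)) \<Longrightarrow> orthogonal z w" and b: "b = y + z"
    using orthogonal_subspace_decomp_exists[of "range (\<lambda>u. A *v (A *v u))" b] unfolding sub by metis
  have sq: "norm (A *v v)^2 = v \<bullet> (A *v (A *v v))" for v
    by (metis sym dot_square_norm inner_commute)
  \<comment> \<open>The orthogonal part \<open>z\<close> of \<open>b\<close> is killed by \<open>A\<^sup>2\<close>, hence by \<open>A\<close>, hence it is orthogonal to \<open>b\<close>.\<close>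
  have "z \<bullet> (A *v (A *v (A *v (A *v z)))) = 0"
    using z unfolding orthogonal_def by blast
  then have "A *v (A *v z) = 0"
    using sq[of "A *v z"] by (metis sym inner_commute norm_eq_zero power2_eq_square mult_eq_0_iff
        dot_square_norm)
  then have "A *v z = 0"
    using sq[of z] by simp
  then have "z \<bullet> b = 0" by (rule ker)
  moreover have "z \<bullet> y = 0" using z[OF y] by (simp add: orthogonal_def)
  ultimately have "z = 0" by (simp add: b inner_add_right)
  with y b that show ?thesis by auto
qed

section \<open>Square-integrable functions\<close>

definition square_integrable :: "'a measure \<Rightarrow> ('a \<Rightarrow> real) \<Rightarrow> bool" where
  "square_integrable M f \<longleftrightarrow> f \<in> borel_measurable M \<and> integrable M (\<lambda>x. (f x)\<^sup>2)"

lemma square_integrable_mult: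
  assumes "square_integrable M f" "square_integrable M g"
  shows "integrable M (\<lambda>x. f x * g x)"
proof (rule Bochner_Integration.integrable_bound)
  show "integrable M (\<lambda>x. (f x)\<^sup>2 + (g x)\<^sup>2)"
    using assms by (auto simp: square_integrable_def)
  show "(\<lambda>x. f x * g x) \<in> borel_measurable M"
    using assms by (auto simp: square_integrable_def)
  have le: "\<bar>a * b\<bar> \<le> a\<^sup>2 + b\<^sup>2" for a b :: real
    using sum_squares_bound[of "\<bar>a\<bar>" "\<bar>b\<bar>"] abs_ge_zero[of "a * b"]
    unfolding abs_mult mult.assoc power2_abs by linarith
  have "norm (f x * g x) \<le> norm ((f x)\<^sup>2 + (g x)\<^sup>2)" for x
    using le[of "f x" "g x"] by simp
  then show "AE x in M. norm (f x * g x) \<le> norm ((f x)\<^sup>2 + (g x)\<^sup>2)"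
    by (rule AE_I2)
qed

lemma square_integrable_bound:
  assumes "square_integrable M g" "f \<in> borel_measurable M" "\<And>x. \<bar>f x\<bar> \<le> \<bar>g x\<bar>"
  shows "square_integrable M f"
  unfolding square_integrable_def
proof
  have [measurable]: "f \<in> borel_measurable M" by fact
  show "integrable M (\<lambda>x. (f x)\<^sup>2)"
  proof (rule Bochner_Integration.integrable_bound)
    show "integrable M (\<lambda>x. (g x)\<^sup>2)"
      using assms(1) by (simp add: square_integrable_def)
    have "norm ((f x)\<^sup>2) \<le> norm ((g x)\<^sup>2)" for x
      using assms(3)[of x] by (simp add: abs_le_square_iff)
    then show "AE x in M. norm ((f x)\<^sup>2) \<le> norm ((g x)\<^sup>2)" by (rule AE_I2)
  qed measurable
qed (rule assms)

lemma square_integrable_cmult [intro]: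
  "square_integrable M f \<Longrightarrow> square_integrable M (\<lambda>x. c * f x)"
  by (auto simp: square_integrable_def power_mult_distrib)

lemma square_integrable_add [intro]:
  assumes "square_integrable M f" "square_integrable M g"
  shows "square_integrable M (\<lambda>x. f x + g x)"
  using assms square_integrable_mult[OF assms]
  by (auto simp: square_integrable_def power2_sum mult.assoc)

lemma square_integrable_diff [intro]:
  assumes "square_integrable M f" "square_integrable M g"
  shows "square_integrable M (\<lambda>x. f x - g x)"
  using square_integrable_add[OF assms(1) square_integrable_cmult[OF assms(2), of "-1"]] by simp

lemma square_integrable_Cauchy_Schwarz:
  assumes f: "square_integrable M f" and g: "square_integrable M g"
  shows "(LINT x|M. f x * g x) \<le> sqrt (LINT x|M. (f x)\<^sup>2) * sqrt (LINT x|M. (g x)\<^sup>2)"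
proof -
  have null: "(LINT x|M. f x * g x) = 0"
    if f: "square_integrable M f" and 0: "(LINT x|M. (f x)\<^sup>2) = 0" for f g
  proof -
    have "AE x in M. (f x)\<^sup>2 = 0"
      using f 0 by (subst (asm) integral_nonneg_eq_0_iff_AE) (auto simp: square_integrable_def)
    then have "AE x in M. f x * g x = 0" by auto
    then show ?thesis by (rule integral_eq_zero_AE)
  qed
  define a where "a = sqrt (LINT x|M. (f x)\<^sup>2)"
  define b where "b = sqrt (LINT x|M. (g x)\<^sup>2)"
  have a: "a\<^sup>2 = (LINT x|M. (f x)\<^sup>2)" "0 \<le> a" and b: "b\<^sup>2 = (LINT x|M. (g x)\<^sup>2)" "0 \<le> b"
    by (auto simp: a_def b_def)
  show ?thesis
  proof (cases "a = 0 \<or> b = 0")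
    case True
    then show ?thesis
      using null[OF f, of g] null[OF g, of f] a b
      by (auto simp: mult.commute)
  next
    case False
    \<comment> \<open>This combination makes the two squares contribute equally, \<open>a\<^sup>2 b\<^sup>2\<close> each.\<close>
    have "0 \<le> (LINT x|M. (b * f x - a * g x)\<^sup>2)" by simp
    also have "\<dots> = (LINT x|M. b\<^sup>2 * (f x)\<^sup>2 + a\<^sup>2 * (g x)\<^sup>2 - (2 * a * b) * (f x * g x))"
      by (simp add: power2_diff power_mult_distrib algebra_simps)
    also have "\<dots> = b\<^sup>2 * a\<^sup>2 + a\<^sup>2 * b\<^sup>2 - (2 * a * b) * (LINT x|M. f x * g x)"
      using f g square_integrable_mult[OF f g] by (simp add: a(1) b(1) square_integrable_def)
    finally have "(a * b) * (LINT x|M. f x * g x) \<le> (a * b) * (a * b)"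
      by (simp add: power2_eq_square algebra_simps)
    moreover have "0 < a * b" using False a b by simp
    ultimately show ?thesis unfolding a_def[symmetric] b_def[symmetric] by (simp only: mult_le_cancel_left_pos)
  qed
qed

context finite_measure
begin

lemma square_integrable_const [intro, simp]: "square_integrable M (\<lambda>_. c)"
  by (simp add: square_integrable_def)

lemma integrable_of_square_integrable: "square_integrable M f \<Longrightarrow> integrable M f"
  by (auto simp: square_integrable_def intro: square_integrable_imp_integrable)

end

section \<open>Moments of the squared error\<close>

text \<open>One point of finite risk suffices: it makes every squared error square-integrable
  (\<open>square_integrable_sq_err\<close>).\<close>

locale finite_risk_space = prob_space M for M :: "(real ^ 'n) measure" +
  assumes sets_M: "sets M = sets borel"
    and finite_risk_nonempty: "finite_risk M \<noteq> {}"
begin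

lemma measurable_id_M [measurable]: "(\<lambda>\<xi>. \<xi>) \<in> borel_measurable M"
  by (rule measurable_ident_sets[OF sets_M])

lemma measurable_sq_err [measurable]: "sq_err x \<in> borel_measurable M"
  unfolding sq_err_def[abs_def] by measurable

lemma square_integrable_sq_err [intro, simp]: "square_integrable M (sq_err y)"
proof -
  obtain x where "x \<in> finite_risk M" using finite_risk_nonempty by blast
  then have x: "square_integrable M (sq_err x)"
    by (simp add: square_integrable_def finite_risk_def measurable_sq_err)
  have g: "square_integrable M (\<lambda>\<xi>. 2 * sq_err x \<xi> + 2 * (norm (x - y))\<^sup>2)"
    using x by auto
  have "\<bar>sq_err y \<xi>\<bar> \<le> \<bar>2 * sq_err x \<xi> + 2 * (norm (x - y))\<^sup>2\<bar>" for \<xi>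
  proof -
    have "norm (\<xi> - y) \<le> norm (\<xi> - x) + norm (x - y)"
      using norm_triangle_ineq[of "\<xi> - x" "x - y"] by simp
    then have "(norm (\<xi> - y))\<^sup>2 \<le> (norm (\<xi> - x) + norm (x - y))\<^sup>2"
      by (intro power_mono) auto
    also have "\<dots> \<le> 2 * (norm (\<xi> - x))\<^sup>2 + 2 * (norm (x - y))\<^sup>2"
      using sum_squares_bound[of "norm (\<xi> - x)" "norm (x - y)"] by (simp add: power2_sum)
    finally show ?thesis by (simp add: sq_err_def)
  qed
  then show ?thesis
    by (intro square_integrable_bound[OF g measurable_sq_err])
qed

lemma square_integrable_norm [intro, simp]: "square_integrable M (\<lambda>\<xi>. norm (\<xi> - a))"
proof (rule square_integrable_bound)
  show "square_integrable M (\<lambda>\<xi>. 1 + sq_err a \<xi>)" by auto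
  have le: "t \<le> 1 + t\<^sup>2" for t :: real
    using sum_squares_bound[of t 1] zero_le_power2[of t] unfolding one_power2 mult_1_right by linarith
  show "\<bar>norm (\<xi> - a)\<bar> \<le> \<bar>1 + sq_err a \<xi>\<bar>" for \<xi>
    using le[of "norm (\<xi> - a)"] by (simp add: sq_err_def)
qed measurable

lemma square_integrable_inner [intro, simp]: "square_integrable M (\<lambda>\<xi>. v \<bullet> (\<xi> - a))"
proof (rule square_integrable_bound)
  show "square_integrable M (\<lambda>\<xi>. norm v * norm (\<xi> - a))" by auto
  show "\<bar>v \<bullet> (\<xi> - a)\<bar> \<le> \<bar>norm v * norm (\<xi> - a)\<bar>" for \<xi>
    using Cauchy_Schwarz_ineq2 by simp
qed measurable

lemma integrable_scaleR_vector:
  assumes "square_integrable M f"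
  shows "integrable M (\<lambda>\<xi>. f \<xi> *\<^sub>R (\<xi> - a))"
proof (rule Bochner_Integration.integrable_bound)
  show "integrable M (\<lambda>\<xi>. f \<xi> * norm (\<xi> - a))"
    using assms by (intro square_integrable_mult) auto
  have [measurable]: "f \<in> borel_measurable M"
    using assms by (simp add: square_integrable_def)
  show "(\<lambda>\<xi>. f \<xi> *\<^sub>R (\<xi> - a)) \<in> borel_measurable M"
    by measurable
qed simp

lemma integrable_id [simp]: "integrable M (\<lambda>\<xi>. \<xi>)"
  using integrable_scaleR_vector[of "\<lambda>_. 1" 0] by simp

lemma integrable_centered [simp]: "integrable M (\<lambda>\<xi>. \<xi> - a)"
  using integrable_scaleR_vector[of "\<lambda>_. 1"] by simp

lemma integral_centered: "(LINT \<xi>|M. \<xi> - mean M) = 0"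
  by (simp add: mean_def prob_space)

lemma integral_inner_centered: "(LINT \<xi>|M. v \<bullet> (\<xi> - mean M)) = 0"
  using integral_inner_right[OF integrable_centered, of v "mean M"]
  by (simp only: integral_centered inner_zero_right)

lemma sq_err_shift: "sq_err y \<xi> = sq_err x \<xi> - 2 * ((y - x) \<bullet> (\<xi> - x)) + (norm (y - x))\<^sup>2"
  unfolding sq_err_def power2_norm_eq_inner by (simp add: algebra_simps inner_commute)

lemma mean_err_eq: "mean_err M y = (norm (y - mean M))\<^sup>2 + mmse M"
proof -
  have int: "integrable M (\<lambda>\<xi>. v \<bullet> (\<xi> - a))" "integrable M (sq_err x)" for v a x
    by (auto intro: integrable_of_square_integrable)
  have "mean_err M y = (LINT \<xi>|M. sq_err (mean M) \<xi> - 2 * ((y - mean M) \<bullet> (\<xi> - mean M))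
      + (norm (y - mean M))\<^sup>2)"
    unfolding mean_err_def by (intro Bochner_Integration.integral_cong refl sq_err_shift)
  also have "\<dots> = (LINT \<xi>|M. sq_err (mean M) \<xi>) + (norm (y - mean M))\<^sup>2"
    using int by (simp add: integral_inner_centered prob_space)
  finally show ?thesis by (simp add: mmse_def sq_err_def)
qed

lemma mean_err_shift:
  "mean_err M y = mean_err M x + 2 * ((y - x) \<bullet> (x - mean M)) + (norm (y - x))\<^sup>2"
  unfolding mean_err_eq power2_norm_eq_inner by (simp add: algebra_simps inner_commute)

definition centered_err :: "real ^ 'n \<Rightarrow> real ^ 'n \<Rightarrow> real" where
  "centered_err x \<xi> = sq_err x \<xi> - mean_err M x"

definition err_cov :: "real ^ 'n \<Rightarrow> real ^ 'n" where
  "err_cov x = (LINT \<xi>|M. centered_err x \<xi> *\<^sub>R (\<xi> - mean M))"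

lemma square_integrable_centered_err [intro, simp]: "square_integrable M (centered_err x)"
  unfolding centered_err_def by auto

lemma integral_centered_err: "(LINT \<xi>|M. centered_err x \<xi>) = 0"
  unfolding centered_err_def
  by (simp add: integrable_of_square_integrable prob_space mean_err_def[symmetric])

lemma var_err_eq: "var_err M x = (LINT \<xi>|M. (centered_err x \<xi>)\<^sup>2)"
  by (simp add: var_err_def centered_err_def)

lemma var_err_nonneg [simp]: "0 \<le> var_err M x"
  by (simp add: var_err_eq)

text \<open>The quadratic term in \<open>\<xi>\<close> cancels; all dependence of the risk on the estimator comes from this
  linear change.\<close>

lemma centered_err_shift:
  "centered_err y \<xi> = centered_err x \<xi> - 2 * ((y - x) \<bullet> (\<xi> - mean M))"
  unfolding centered_err_def mean_err_eq sq_err_def power2_norm_eq_inner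
  by (simp add: algebra_simps inner_commute)

lemma inner_cov_matrix:
  "v \<bullet> (cov_matrix M *v w) = (LINT \<xi>|M. (v \<bullet> (\<xi> - mean M)) * (w \<bullet> (\<xi> - mean M)))"
proof -
  have comp: "integrable M (\<lambda>\<xi>. (\<xi> $ i - mean M $ i) * (\<xi> $ j - mean M $ j))" for i j
    using square_integrable_mult[OF square_integrable_inner[of "axis i 1" "mean M"]
        square_integrable_inner[of "axis j 1" "mean M"]]
    by (simp add: inner_axis')
  have "(v \<bullet> (\<xi> - mean M)) * (w \<bullet> (\<xi> - mean M))
      = (\<Sum>i\<in>UNIV. \<Sum>j\<in>UNIV. v $ i * w $ j * ((\<xi> $ i - mean M $ i) * (\<xi> $ j - mean M $ j)))" for \<xi>
    by (simp add: inner_vec_def sum_product mult_ac)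
  then have "(LINT \<xi>|M. (v \<bullet> (\<xi> - mean M)) * (w \<bullet> (\<xi> - mean M)))
      = (\<Sum>i\<in>UNIV. \<Sum>j\<in>UNIV. v $ i * w $ j * cov_matrix M $ i $ j)"
    using comp by (simp add: cov_matrix_def Bochner_Integration.integral_sum)
  also have "\<dots> = v \<bullet> (cov_matrix M *v w)"
    by (simp add: inner_vec_def matrix_vector_mult_def sum_distrib_left mult_ac)
  finally show ?thesis ..
qed

lemma cov_matrix_sym: "v \<bullet> (cov_matrix M *v w) = w \<bullet> (cov_matrix M *v v)"
  by (simp add: inner_cov_matrix mult.commute)

lemma cov_matrix_psd: "0 \<le> v \<bullet> (cov_matrix M *v v)"
  by (simp add: inner_cov_matrix)

lemma inner_err_cov:
  "v \<bullet> err_cov x = (LINT \<xi>|M. centered_err x \<xi> * (v \<bullet> (\<xi> - mean M)))"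
  unfolding err_cov_def
  using integral_inner_right[OF integrable_scaleR_vector[OF square_integrable_centered_err], of v x "mean M"]
  by simp

lemma err_cov_shift: "err_cov y = err_cov x - 2 *\<^sub>R (cov_matrix M *v (y - x))"
proof (rule vector_eq_ldot[THEN iffD1], rule allI)
  fix v
  have "v \<bullet> err_cov y = (LINT \<xi>|M. centered_err x \<xi> * (v \<bullet> (\<xi> - mean M))
      - 2 * ((v \<bullet> (\<xi> - mean M)) * ((y - x) \<bullet> (\<xi> - mean M))))"
    unfolding inner_err_cov by (subst centered_err_shift[of y _ x]) (simp add: algebra_simps)
  also have "\<dots> = v \<bullet> err_cov x - 2 * (v \<bullet> (cov_matrix M *v (y - x)))"
    unfolding inner_err_cov inner_cov_matrix
    by (subst Bochner_Integration.integral_diff) (auto intro!: square_integrable_mult)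
  finally show "v \<bullet> err_cov y = v \<bullet> (err_cov x - 2 *\<^sub>R (cov_matrix M *v (y - x)))"
    by (simp add: inner_diff_right)
qed

lemma var_err_shift:
  "var_err M y = var_err M x - 4 * ((y - x) \<bullet> err_cov x)
     + 4 * ((y - x) \<bullet> (cov_matrix M *v (y - x)))"
proof -
  let ?p = "\<lambda>\<xi>. (y - x) \<bullet> (\<xi> - mean M)"
  have "var_err M y = (LINT \<xi>|M. (centered_err x \<xi>)\<^sup>2 - 4 * (centered_err x \<xi> * ?p \<xi>) + 4 * (?p \<xi> * ?p \<xi>))"
    unfolding var_err_eq
    by (subst centered_err_shift[of y _ x]) (simp add: power2_eq_square algebra_simps)
  also have "\<dots> = (LINT \<xi>|M. (centered_err x \<xi>)\<^sup>2) - 4 * (LINT \<xi>|M. centered_err x \<xi> * ?p \<xi>)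
      + 4 * (LINT \<xi>|M. ?p \<xi> * ?p \<xi>)"
  proof -
    have "integrable M (\<lambda>\<xi>. (centered_err x \<xi>)\<^sup>2)"
      using square_integrable_centered_err[of x] unfolding square_integrable_def by blast
    moreover have "integrable M (\<lambda>\<xi>. centered_err x \<xi> * ?p \<xi>)" "integrable M (\<lambda>\<xi>. ?p \<xi> * ?p \<xi>)"
      by (simp_all add: square_integrable_mult)
    ultimately show ?thesis by simp
  qed
  finally show ?thesis by (simp add: var_err_eq inner_err_cov inner_cov_matrix)
qed

lemma inner_err_cov_le:
  "v \<bullet> err_cov x \<le> sqrt (var_err M x) * sqrt (v \<bullet> (cov_matrix M *v v))"
  using square_integrable_Cauchy_Schwarz[OF square_integrable_centered_err[of x]
      square_integrable_inner[of v "mean M"]]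
  by (simp add: inner_err_cov inner_cov_matrix var_err_eq power2_eq_square)

lemma err_cov_eq_0:
  assumes "var_err M x = 0"
  shows "err_cov x = 0"
proof -
  have "err_cov x \<bullet> err_cov x \<le> 0"
    using inner_err_cov_le[of "err_cov x" x] assms by simp
  then show ?thesis
    by (meson inner_eq_zero_iff inner_ge_zero order.antisym)
qed

text \<open>For \<open>var_err M x > 0\<close> this is the tangent inequality of the convex function
  \<open>y \<mapsto> sqrt (var_err M y)\<close> at \<open>x\<close>, multiplied by its value at \<open>x\<close>.  The left-hand side is the
  covariance of the two squared errors.\<close>

lemma std_err_tangent:
  "var_err M x - 2 * ((y - x) \<bullet> err_cov x) \<le> sqrt (var_err M x) * sqrt (var_err M y)"
proof -
  have "(LINT \<xi>|M. centered_err x \<xi> * centered_err y \<xi>) = (LINT \<xi>|M. (centered_err x \<xi>)\<^sup>2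
      - 2 * (centered_err x \<xi> * ((y - x) \<bullet> (\<xi> - mean M))))"
    by (subst centered_err_shift[of y _ x]) (simp add: power2_eq_square algebra_simps)
  also have "\<dots> = var_err M x - 2 * ((y - x) \<bullet> err_cov x)"
    using square_integrable_centered_err[of x]
    unfolding inner_err_cov var_err_eq
    by (subst Bochner_Integration.integral_diff)
      (auto intro!: square_integrable_mult simp: square_integrable_def[of _ "centered_err x"])
  finally show ?thesis
    using square_integrable_Cauchy_Schwarz[OF square_integrable_centered_err[of x]
        square_integrable_centered_err[of y]] by (simp add: var_err_eq)
qed

section \<open>The risk-constrained estimator\<close>

text \<open>The defining linear system of the estimator, written with the covariance at \<open>x\<close> itself instead of
  the one at the origin.\<close>

lemma X_hat_iff_stationary:
  assumes "0 \<le> l"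
  shows "x = X_hat M l \<longleftrightarrow> x - mean M = (2 * l) *\<^sub>R err_cov x"
proof -
  let ?A = "mat 1 + (4 * l) *\<^sub>R cov_matrix M"
  let ?c = "(LINT \<xi>|M. (norm \<xi>)\<^sup>2 *\<^sub>R \<xi>) - (LINT \<xi>|M. (norm \<xi>)\<^sup>2) *\<^sub>R mean M"
  have sq: "square_integrable M (\<lambda>\<xi>. (norm \<xi>)\<^sup>2)"
    using square_integrable_sq_err[of 0] by (simp add: sq_err_def[abs_def])
  have 0: "centered_err 0 \<xi> = (norm \<xi>)\<^sup>2 - (LINT \<xi>|M. (norm \<xi>)\<^sup>2)" for \<xi>
    by (simp add: centered_err_def mean_err_def sq_err_def)
  \<comment> \<open>The vector in the definition of the estimator is the covariance at the origin.\<close>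
  have "err_cov 0 = (LINT \<xi>|M. centered_err 0 \<xi> *\<^sub>R (\<xi> - 0) - centered_err 0 \<xi> *\<^sub>R mean M)"
    unfolding err_cov_def by (simp add: scaleR_diff_right)
  also have "\<dots> = (LINT \<xi>|M. centered_err 0 \<xi> *\<^sub>R (\<xi> - 0)) - (LINT \<xi>|M. centered_err 0 \<xi> *\<^sub>R mean M)"
    by (intro Bochner_Integration.integral_diff integrable_scaleR_vector integrable_scaleR_left
        integrable_of_square_integrable) auto
  also have "\<dots> = (LINT \<xi>|M. (norm \<xi>)\<^sup>2 *\<^sub>R (\<xi> - 0) - (LINT \<xi>|M. (norm \<xi>)\<^sup>2) *\<^sub>R \<xi>)"
    by (simp add: integral_centered_err integrable_of_square_integrable)
      (simp add: 0 scaleR_diff_left)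
  also have "\<dots> = ?c"
    using integrable_scaleR_vector[OF sq, of 0] by (simp add: mean_def)
  finally have c: "err_cov 0 = ?c" .
  have inv: "invertible ?A"
    using assms by (intro psd_resolvent_invertible cov_matrix_psd) auto
  have "X_hat M l = matrix_inv ?A *v (mean M + (2 * l) *\<^sub>R err_cov 0)"
    by (simp add: X_hat_def c)
  then have "x = X_hat M l \<longleftrightarrow> ?A *v x = mean M + (2 * l) *\<^sub>R err_cov 0"
    using matrix_inv_inverse[OF inv] by (metis matrix_vector_mul_assoc matrix_vector_mul_lid)
  also have "\<dots> \<longleftrightarrow> x - mean M = (2 * l) *\<^sub>R err_cov x"
    unfolding err_cov_shift[of x 0]
    by (simp add: matrix_vector_mult_add_rdistrib scaleR_matrix_vector_assoc[symmetric] algebra_simps)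
  finally show ?thesis .
qed

lemma X_hat_stationary: "0 \<le> l \<Longrightarrow> X_hat M l - mean M = (2 * l) *\<^sub>R err_cov (X_hat M l)"
  using X_hat_iff_stationary by blast

lemma X_hat_0: "X_hat M 0 = mean M"
  using X_hat_stationary[of 0] by simp

text \<open>Stationarity cancels the linear terms of the expansion around the estimator; the quadratic term of
  the mean error is kept as the modulus of strong convexity, that of the variance is dropped.\<close>

lemma lagrangian_X_hat:
  assumes "0 \<le> l"
  shows "mean_err M (X_hat M l) + l * var_err M (X_hat M l) + (norm (y - X_hat M l))\<^sup>2
    \<le> mean_err M y + l * var_err M y"
proof -
  let ?x = "X_hat M l"
  have "(y - ?x) \<bullet> (?x - mean M) = 2 * l * ((y - ?x) \<bullet> err_cov ?x)"
    by (subst X_hat_stationary[OF assms]) simp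
  moreover have "0 \<le> l * ((y - ?x) \<bullet> (cov_matrix M *v (y - ?x)))"
    using assms cov_matrix_psd by simp
  ultimately show ?thesis
    unfolding mean_err_shift[of y ?x] var_err_shift[of y ?x] by (simp add: algebra_simps)
qed

lemma lagrangian_minimizer_unique:
  assumes "0 \<le> l"
    and "mean_err M x + l * var_err M x \<le> mean_err M (X_hat M l) + l * var_err M (X_hat M l)"
  shows "x = X_hat M l"
proof -
  have "(norm (x - X_hat M l))\<^sup>2 \<le> 0"
    using lagrangian_X_hat[OF assms(1), of x] assms(2) by linarith
  then show ?thesis by simp
qed

text \<open>Put \<open>d = X_hat M t - mean M\<close> and \<open>S = cov_matrix M\<close>.  A direction without variance is uncorrelated
  with the error, so the covariance at the mean has the form \<open>S\<^sup>2 u\<close>, and stationarity becomes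
  \<open>d = 4 t S (a - d)\<close> with \<open>a = S u / 2\<close>.  The contraction lemma gives \<open>norm d \<le> norm a\<close>.
  The defect \<open>a - d\<close> solves an equation of the same form whose bound is
  \<open>norm u / (8 t)\<close>, so \<open>d\<close> converges to \<open>a\<close>.\<close>

lemma norm_X_hat_le_X_hat_inf:
  assumes "0 \<le> l"
  shows "norm (X_hat M l - mean M) \<le> norm (X_hat_inf M - mean M)"
proof -
  let ?S = "cov_matrix M"
  obtain u where u: "err_cov (mean M) = ?S *v (?S *v u)"
  proof (rule symmetric_range_square)
    show "v \<bullet> (?S *v w) = w \<bullet> (?S *v v)" for v w by (rule cov_matrix_sym)
    show "z \<bullet> err_cov (mean M) = 0" if "?S *v z = 0" for z
    proof -
      have "?S *v (- z) = 0"
        using that matrix_vector_mult_diff_distrib[of ?S 0 z] by simp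
      then show ?thesis
        using inner_err_cov_le[of z "mean M"] inner_err_cov_le[of "- z" "mean M"] that by simp
    qed
  qed
  define a where "a = (1/2) *\<^sub>R (?S *v u)"
  have d: "X_hat M t - mean M = (4 * t) *\<^sub>R (?S *v (a - (X_hat M t - mean M)))" if "0 \<le> t" for t
  proof -
    have "X_hat M t - mean M = (2 * t) *\<^sub>R (?S *v (?S *v u) - 2 *\<^sub>R (?S *v (X_hat M t - mean M)))"
      using X_hat_stationary[OF that] err_cov_shift[of "X_hat M t" "mean M"] u by simp
    also have "\<dots> = (4 * t) *\<^sub>R (?S *v (a - (X_hat M t - mean M)))"
      by (simp add: a_def matrix_vector_mult_diff_distrib matrix_vector_mult_scaleR algebra_simps)
    finally show ?thesis .
  qed
  have bound: "norm (X_hat M t - (mean M + a)) \<le> norm u / (8 * t)" if "0 < t" for t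
  proof -
    define e where "e = a - (X_hat M t - mean M)"
    have "e = a - (4 * t) *\<^sub>R (?S *v e)"
      using d[of t] that by (simp add: e_def)
    also have "\<dots> = (4 * t) *\<^sub>R (?S *v ((1 / (8 * t)) *\<^sub>R u - e))"
      using that
      by (simp add: a_def matrix_vector_mult_diff_distrib matrix_vector_mult_scaleR scaleR_diff_right)
    finally have "norm e \<le> norm ((1 / (8 * t)) *\<^sub>R u)"
      using that by (intro psd_resolvent_norm_le[OF cov_matrix_psd, of "4 * t"]) auto
    then show ?thesis
      using that by (simp add: e_def norm_minus_commute algebra_simps)
  qed
  have "((\<lambda>t. X_hat M t) \<longlongrightarrow> mean M + a) at_top"
  proof (rule Lim_null[THEN iffD2], rule Lim_null_comparison)
    show "\<forall>\<^sub>F t in at_top. norm (X_hat M t - (mean M + a)) \<le> norm u / (8 * t)"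
      using eventually_gt_at_top[of 0] by eventually_elim (rule bound)
    show "((\<lambda>t. norm u / (8 * t)) \<longlongrightarrow> 0) at_top"
      by (intro tendsto_divide_0[OF tendsto_const] filterlim_at_top_imp_at_infinity
          filterlim_tendsto_pos_mult_at_top[OF tendsto_const] filterlim_ident) simp
  qed
  then have "X_hat_inf M - mean M = a"
    unfolding X_hat_inf_def by (subst tendsto_Lim) auto
  then show ?thesis
    using psd_resolvent_norm_le[OF cov_matrix_psd _ d[OF assms]] assms by simp
qed

section \<open>Densities in the chi-square ball\<close>

lemma chi2_ball_square_integrable: "h \<in> chi2_ball M \<rho> \<Longrightarrow> square_integrable M h"
  by (simp add: chi2_ball_def square_integrable_def)

lemma nu_star_eq: "nu_star M k x \<xi> = k / sqrt (var_err M x) * centered_err x \<xi> + 1"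
  by (simp add: nu_star_def centered_err_def)

text \<open>The divergence is exactly \<open>k\<^sup>2\<close> unless the variance vanishes, when the density is constant.\<close>

lemma nu_star_in_chi2_ball: "nu_star M k x \<in> chi2_ball M (k\<^sup>2)"
proof -
  have sq: "square_integrable M (nu_star M k x)"
    unfolding nu_star_eq[abs_def]
    by (intro square_integrable_add square_integrable_cmult square_integrable_centered_err
        square_integrable_const)
  have "(LINT \<xi>|M. nu_star M k x \<xi>) = 1"
    by (simp add: nu_star_eq integrable_of_square_integrable integral_centered_err prob_space)
  moreover have "(LINT \<xi>|M. (nu_star M k x \<xi> - 1)\<^sup>2) = (k / sqrt (var_err M x))\<^sup>2 * var_err M x"
    by (simp only: nu_star_eq add_diff_cancel_right' power_mult_distrib var_err_eq integral_mult_right_zero)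
  moreover have "\<dots> \<le> k\<^sup>2"
    by (cases "var_err M x = 0") (simp_all add: power_divide)
  ultimately show ?thesis
    using sq by (simp add: chi2_ball_def square_integrable_def)
qed

text \<open>The normalization of the density allows the squared error to be centered.\<close>

lemma f_obj_eq:
  assumes "h \<in> chi2_ball M \<rho>"
  shows "f_obj M h x = mean_err M x + (LINT \<xi>|M. (h \<xi> - 1) * centered_err x \<xi>)"
proof -
  have h: "square_integrable M h" and h1: "(LINT \<xi>|M. h \<xi>) = 1"
    using assms by (auto simp: chi2_ball_square_integrable chi2_ball_def)
  have "f_obj M h x = (LINT \<xi>|M. mean_err M x * h \<xi> + centered_err x \<xi> + (h \<xi> - 1) * centered_err x \<xi>)"
    unfolding f_obj_def by (rule Bochner_Integration.integral_cong)
      (simp_all add: centered_err_def algebra_simps)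
  also have "\<dots> = mean_err M x * (LINT \<xi>|M. h \<xi>) + (LINT \<xi>|M. centered_err x \<xi>)
      + (LINT \<xi>|M. (h \<xi> - 1) * centered_err x \<xi>)"
    using h square_integrable_mult[OF square_integrable_diff[OF h square_integrable_const]
        square_integrable_centered_err]
    by (simp add: integrable_of_square_integrable)
  finally show ?thesis by (simp add: h1 integral_centered_err)
qed

lemma f_obj_le:
  assumes "h \<in> chi2_ball M (k\<^sup>2)" "0 \<le> k"
  shows "f_obj M h x \<le> mean_err M x + k * sqrt (var_err M x)"
proof -
  have "(LINT \<xi>|M. (h \<xi> - 1) * centered_err x \<xi>)
      \<le> sqrt (LINT \<xi>|M. (h \<xi> - 1)\<^sup>2) * sqrt (var_err M x)"
    unfolding var_err_eq
    by (intro square_integrable_Cauchy_Schwarz square_integrable_diff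
        chi2_ball_square_integrable[OF assms(1)]) auto
  also have "\<dots> \<le> k * sqrt (var_err M x)"
    using assms by (intro mult_right_mono real_le_lsqrt) (auto simp: chi2_ball_def)
  finally show ?thesis by (simp add: f_obj_eq[OF assms(1)])
qed

lemma f_obj_nu_star:
  "f_obj M (nu_star M k x) x = mean_err M x + k * sqrt (var_err M x)"
proof -
  have "(LINT \<xi>|M. (nu_star M k x \<xi> - 1) * centered_err x \<xi>) = k / sqrt (var_err M x) * var_err M x"
    by (simp add: nu_star_eq var_err_eq power2_eq_square mult.assoc)
  also have "\<dots> = k * sqrt (var_err M x)"
    using real_div_sqrt[of "var_err M x"] by (simp flip: times_divide_eq_right)
  finally show ?thesis by (simp add: f_obj_eq[OF nu_star_in_chi2_ball])
qed

text \<open>For a signed density of total mass one the objective is still a parabola in the estimator, with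
  leading coefficient one and vertex at the mean of the density.\<close>

lemma f_obj_best_response:
  assumes "h \<in> chi2_ball M \<rho>"
  shows "f_obj M h y = f_obj M h (best_response M h) + (norm (y - best_response M h))\<^sup>2"
proof -
  let ?a = "best_response M h"
  have h: "square_integrable M h" and h1: "(LINT \<xi>|M. h \<xi>) = 1"
    using assms by (auto simp: chi2_ball_square_integrable chi2_ball_def)
  have "(LINT \<xi>|M. h \<xi> *\<^sub>R (\<xi> - ?a)) = (LINT \<xi>|M. h \<xi> *\<^sub>R (\<xi> - 0) - h \<xi> *\<^sub>R ?a)"
    by (simp add: scaleR_diff_right)
  also have "\<dots> = 0"
    using integrable_scaleR_vector[OF h, of 0] integrable_of_square_integrable[OF h]
    by (simp add: h1 best_response_def)
  finally have "(LINT \<xi>|M. h \<xi> * ((y - ?a) \<bullet> (\<xi> - ?a))) = 0"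
    using integral_inner_right[OF integrable_scaleR_vector[OF h], of "y - ?a" ?a] by simp
  moreover have "f_obj M h y = (LINT \<xi>|M. h \<xi> * sq_err ?a \<xi> - 2 * (h \<xi> * ((y - ?a) \<bullet> (\<xi> - ?a)))
      + (norm (y - ?a))\<^sup>2 * h \<xi>)"
    unfolding f_obj_def by (subst sq_err_shift[of y _ ?a]) (simp add: algebra_simps)
  moreover have "\<dots> = f_obj M h ?a - 2 * (LINT \<xi>|M. h \<xi> * ((y - ?a) \<bullet> (\<xi> - ?a)))
      + (norm (y - ?a))\<^sup>2 * (LINT \<xi>|M. h \<xi>)"
    unfolding f_obj_def
    using square_integrable_mult[OF h square_integrable_sq_err[of ?a]]
      square_integrable_mult[OF h square_integrable_inner[of "y - ?a" ?a]]
    by (simp add: integrable_of_square_integrable[OF h])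
  ultimately show ?thesis by (simp add: h1)
qed

lemma best_response_nu_star:
  "best_response M (nu_star M k x) = mean M + (k / sqrt (var_err M x)) *\<^sub>R err_cov x"
proof -
  let ?r = "k / sqrt (var_err M x)"
  have int: "integrable M (\<lambda>\<xi>. ?r *\<^sub>R (centered_err x \<xi> *\<^sub>R (\<xi> - mean M)))"
    "integrable M (\<lambda>\<xi>. centered_err x \<xi> *\<^sub>R (?r *\<^sub>R mean M))"
    by (intro integrable_scaleR_right integrable_scaleR_vector integrable_scaleR_left
        integrable_of_square_integrable square_integrable_centered_err)+
  have "best_response M (nu_star M k x) = (LINT \<xi>|M. ?r *\<^sub>R (centered_err x \<xi> *\<^sub>R (\<xi> - mean M))
      + (centered_err x \<xi> *\<^sub>R (?r *\<^sub>R mean M) + \<xi>))"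
    unfolding best_response_def nu_star_eq by (simp add: algebra_simps)
  also have "\<dots> = (LINT \<xi>|M. ?r *\<^sub>R (centered_err x \<xi> *\<^sub>R (\<xi> - mean M)))
      + ((LINT \<xi>|M. centered_err x \<xi> *\<^sub>R (?r *\<^sub>R mean M)) + (LINT \<xi>|M. \<xi>))"
    using int by (subst Bochner_Integration.integral_add | simp del: scaleR_scaleR)+
  also have "\<dots> = ?r *\<^sub>R err_cov x + (LINT \<xi>|M. centered_err x \<xi>) *\<^sub>R (?r *\<^sub>R mean M) + mean M"
    unfolding err_cov_def mean_def[symmetric]
    by (subst integral_scaleR_left)
      (simp_all del: scaleR_scaleR add: integrable_of_square_integrable)
  finally show ?thesis by (simp add: integral_centered_err)
qed

lemma saddle_point_of_fixed_best_response:
  assumes "0 \<le> k" and resp: "best_response M (nu_star M k x) = x"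
  shows "saddle_point (f_obj M) (chi2_ball M (k\<^sup>2)) UNIV (nu_star M k x) x"
  unfolding saddle_point_def
proof (intro conjI ballI)
  show "f_obj M h x \<le> f_obj M (nu_star M k x) x" if "h \<in> chi2_ball M (k\<^sup>2)" for h
    using f_obj_le[OF that \<open>0 \<le> k\<close>] by (simp add: f_obj_nu_star)
  show "f_obj M (nu_star M k x) x \<le> f_obj M (nu_star M k x) y" for y
    using f_obj_best_response[OF nu_star_in_chi2_ball, of k x y] by (simp add: resp)
qed (simp_all add: nu_star_in_chi2_ball)

section \<open>The mean-deviation multiplier\<close>

lemma finite_risk_UNIV: "finite_risk M = UNIV"
  using square_integrable_sq_err by (auto simp: finite_risk_def square_integrable_def)

lemma risk_multiplierD:
  assumes "risk_multiplier M \<epsilon> l"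
  shows "0 \<le> l" "var_err M (X_hat M l) \<le> \<epsilon>" "l * \<epsilon> = l * var_err M (X_hat M l)"
proof -
  obtain x where l: "0 \<le> l" and feas: "var_err M x \<le> \<epsilon>"
    and opt: "\<And>y. mean_err M x \<le> mean_err M y + l * (var_err M y - \<epsilon>)"
    using assms by (auto simp: risk_multiplier_def optimal_multiplier_def finite_risk_UNIV)
  show "0 \<le> l" by fact
  have slack: "l * var_err M x \<le> l * \<epsilon>" using l feas by (rule mult_left_mono[rotated])
  have "x = X_hat M l"
    using opt[of "X_hat M l"] slack
    by (intro lagrangian_minimizer_unique l) (simp add: right_diff_distrib)
  moreover have "l * \<epsilon> \<le> l * var_err M x"
    using opt[of x] by (simp add: right_diff_distrib)
  ultimately show "var_err M (X_hat M l) \<le> \<epsilon>" "l * \<epsilon> = l * var_err M (X_hat M l)"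
    using feas slack by (metis, metis order.antisym)
qed

text \<open>By the arithmetic--geometric mean inequality, \<open>sqrt (var_err M y)\<close> lies below a multiple of
  \<open>var_err M y\<close> plus a constant, with equality at \<open>y = x\<close>.  So \<open>x\<close> also minimizes the quadratic
  Lagrangian with multiplier \<open>k / (2 * sqrt (var_err M x))\<close>, whose stationarity condition is known.\<close>

lemma md_minimizer_stationary:
  assumes "0 \<le> k" and pos: "var_err M x \<noteq> 0"
    and opt: "\<And>y. mean_err M x + k * sqrt (var_err M x) \<le> mean_err M y + k * sqrt (var_err M y)"
  shows "x - mean M = (k / sqrt (var_err M x)) *\<^sub>R err_cov x"
proof -
  define s where "s = sqrt (var_err M x)"
  define l where "l = k / (2 * s)"
  have s: "0 < s" "s\<^sup>2 = var_err M x" using pos by (auto simp: s_def less_le)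
  have l: "0 \<le> l" using assms s by (simp add: l_def)
  have "mean_err M x + l * var_err M x \<le> mean_err M y + l * var_err M y" for y
  proof -
    have "2 * s * sqrt (var_err M y) \<le> s\<^sup>2 + var_err M y"
      using sum_squares_bound[of s "sqrt (var_err M y)"] by simp
    then have "l * (2 * s * sqrt (var_err M y)) \<le> l * (s\<^sup>2 + var_err M y)"
      using l by (rule mult_left_mono)
    moreover have k: "k = l * (2 * s)" using s by (simp add: l_def)
    ultimately have "k * sqrt (var_err M y) \<le> l * var_err M x + l * var_err M y"
      by (simp add: s(2) algebra_simps)
    moreover have "k * s = 2 * (l * var_err M x)"
      unfolding k s(2)[symmetric] by (simp add: power2_eq_square)
    ultimately show ?thesis using opt[of y] by (simp add: s_def)
  qed
  then have "x = X_hat M l" by (rule lagrangian_minimizer_unique[OF l])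
  then have "x - mean M = (2 * l) *\<^sub>R err_cov x" by (simp only: X_hat_iff_stationary[OF l])
  then show ?thesis by (simp add: l_def s_def)
qed

text \<open>The two constrained problems have the same feasible set and objective.  By strong convexity the
  minimizer that comes with the mean-deviation multiplier must be the risk-constrained estimator.\<close>

lemma md_multiplier_minimizer:
  assumes risk: "risk_multiplier M \<epsilon> l" and md: "md_multiplier M \<epsilon> k"
  shows "0 \<le> k"
    and "mean_err M (X_hat M l) + k * sqrt (var_err M (X_hat M l))
      \<le> mean_err M y + k * sqrt (var_err M y)"
proof -
  note r = risk_multiplierD[OF risk]
  obtain x where k: "0 \<le> k" and feas: "sqrt (var_err M x) \<le> sqrt \<epsilon>"
    and opt: "\<And>y. mean_err M x \<le> mean_err M y + k * (sqrt (var_err M y) - sqrt \<epsilon>)"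
    using md by (auto simp: md_multiplier_def optimal_multiplier_def finite_risk_UNIV)
  show "0 \<le> k" by fact
  have "k * (sqrt (var_err M (X_hat M l)) - sqrt \<epsilon>) \<le> 0"
    using k r(2) by (intro mult_nonneg_nonpos) auto
  moreover have "l * var_err M x \<le> l * \<epsilon>"
    using feas r(1) by (intro mult_left_mono) auto
  ultimately have x: "x = X_hat M l"
    using opt[of "X_hat M l"] r(3) by (intro lagrangian_minimizer_unique r(1)) linarith
  have "k * sqrt (var_err M x) \<le> k * sqrt \<epsilon>"
    using feas k by (rule mult_left_mono)
  then show "mean_err M (X_hat M l) + k * sqrt (var_err M (X_hat M l))
      \<le> mean_err M y + k * sqrt (var_err M y)"
    using opt[of y] by (simp add: x[symmetric] algebra_simps)
qed

text \<open>If the variance of the error vanishes, the standard deviation need not be differentiable at the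
  estimator and optimality for it gives no stationarity equation; there the covariance vanishes too, and the
  risk-constrained problem shows that the estimator is the mean.\<close>

lemma best_response_nu_star_X_hat:
  assumes risk: "risk_multiplier M \<epsilon> l" and md: "md_multiplier M \<epsilon> k"
  shows "best_response M (nu_star M k (X_hat M l)) = X_hat M l"
proof -
  let ?x = "X_hat M l"
  have eq: "?x - mean M = (k / sqrt (var_err M ?x)) *\<^sub>R err_cov ?x"
  proof (cases "var_err M ?x = 0")
    case True
    then show ?thesis
      using X_hat_stationary[OF risk_multiplierD(1)[OF risk]] err_cov_eq_0 by simp
  next
    case False
    then show ?thesis
      using md_multiplier_minimizer[OF risk md] by (intro md_minimizer_stationary)
  qed
  show ?thesis unfolding best_response_nu_star eq[symmetric] by simp
qed

text \<open>The derivative of \<open>l * v\<close> equals that of \<open>c * sqrt v\<close> at \<open>v = \<epsilon> > 0\<close> for \<open>c = 2 * l * sqrt \<epsilon>\<close>.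
  The first-order condition for the estimator then implies global optimality because the standard
  deviation lies above its tangent.\<close>

lemma md_multiplier_of_risk_multiplier:
  assumes risk: "risk_multiplier M \<epsilon> l"
  shows "md_multiplier M \<epsilon> (2 * l * sqrt \<epsilon>)"
proof -
  let ?x = "X_hat M l"
  define s where "s = sqrt (var_err M ?x)"
  note r = risk_multiplierD[OF risk]
  have s: "s * s = var_err M ?x" by (simp add: s_def)
  have \<epsilon>: "0 \<le> \<epsilon>" using r(2) var_err_nonneg order_trans by blast
  \<comment> \<open>Complementary slackness: the constraint is active unless \<open>l = 0\<close>.\<close>
  have ls: "l * sqrt \<epsilon> = l * s"
    using r(3) by (cases "l = 0") (auto simp: s_def)
  have "mean_err M ?x \<le> mean_err M y + 2 * l * sqrt \<epsilon> * (sqrt (var_err M y) - sqrt \<epsilon>)" for y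
  proof -
    have "(y - ?x) \<bullet> (?x - mean M) = 2 * (l * ((y - ?x) \<bullet> err_cov ?x))"
      by (subst X_hat_stationary[OF r(1)]) simp
    then have "mean_err M ?x + 4 * (l * ((y - ?x) \<bullet> err_cov ?x)) \<le> mean_err M y"
      using mean_err_shift[of y ?x] zero_le_power2[of "norm (y - ?x)"] by linarith
    moreover have "l * (s * s - 2 * ((y - ?x) \<bullet> err_cov ?x)) \<le> l * (s * sqrt (var_err M y))"
      using std_err_tangent[of ?x y] r(1) unfolding s s_def[symmetric] by (rule mult_left_mono)
    moreover have "2 * l * sqrt \<epsilon> * (sqrt (var_err M y) - sqrt \<epsilon>)
        = 2 * (l * (s * sqrt (var_err M y))) - 2 * (l * (s * s))"
    proof -
      have "2 * l * sqrt \<epsilon> * (sqrt (var_err M y) - sqrt \<epsilon>)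
          = 2 * ((l * sqrt \<epsilon>) * sqrt (var_err M y)) - 2 * (l * (sqrt \<epsilon> * sqrt \<epsilon>))"
        by (simp only: right_diff_distrib mult.assoc)
      also have "l * (sqrt \<epsilon> * sqrt \<epsilon>) = l * (s * s)"
        unfolding s using r(3) \<epsilon> by simp
      finally show ?thesis by (simp only: ls mult.assoc)
    qed
    ultimately show ?thesis unfolding right_diff_distrib by linarith
  qed
  then show ?thesis
    using r \<epsilon> unfolding md_multiplier_def optimal_multiplier_def finite_risk_UNIV
    by (auto intro!: exI[of _ ?x])
qed

text \<open>The slope of the density in the squared error is \<open>2 * l\<close> or \<open>0\<close>, so the density is smallest where
  the squared error would be zero.\<close>

lemma nu_star_nonneg:
  assumes risk: "risk_multiplier M \<epsilon> l" and "l \<in> Lambda_set M"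
  shows "0 \<le> nu_star M (2 * l * sqrt \<epsilon>) (X_hat M l) \<xi>"
proof -
  let ?x = "X_hat M l"
  note r = risk_multiplierD[OF risk]
  have "(norm (?x - mean M))\<^sup>2 \<le> (norm (X_hat_inf M - mean M))\<^sup>2"
    using norm_X_hat_le_X_hat_inf[OF r(1)] by (rule power_mono) simp
  then have "2 * mean_err M ?x \<le> gamma_star M"
    by (simp add: mean_err_eq gamma_star_def X_hat_0)
  then have "l * (2 * mean_err M ?x) \<le> l * gamma_star M"
    using r(1) by (rule mult_left_mono)
  also have "\<dots> \<le> 1" using assms(2) by (simp add: Lambda_set_def)
  finally have mean: "2 * l * mean_err M ?x \<le> 1" by simp
  define c where "c = 2 * l * sqrt \<epsilon> / sqrt (var_err M ?x)"
  have "c = 2 * l \<or> c = 0"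
  proof (cases "l = 0 \<or> var_err M ?x = 0")
    case False
    then have "\<epsilon> = var_err M ?x" using r(3) by simp
    with False show ?thesis by (simp add: c_def)
  qed (auto simp: c_def)
  moreover have "0 \<le> 2 * l * sq_err ?x \<xi>"
    using r(1) by (simp add: sq_err_def)
  ultimately show ?thesis
    using mean unfolding nu_star_eq centered_err_def right_diff_distrib c_def[symmetric]
    by (elim disjE) simp_all
qed

end

lemma saddle_point_imp_dro_solution:
  assumes saddle: "saddle_point (f_obj M) (chi2_ball M \<rho>) UNIV h x"
    and nonneg: "AE \<xi> in M. 0 \<le> h \<xi>"
  shows "dro_solution M \<rho> x"
  unfolding dro_solution_def
proof
  fix y
  have "dro_obj M \<rho> x \<le> ereal (f_obj M h x)"
    using saddle unfolding dro_obj_def by (intro SUP_least) (auto simp: saddle_point_def)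
  also have "\<dots> \<le> ereal (f_obj M h y)"
    using saddle by (simp add: saddle_point_def)
  also have "\<dots> \<le> dro_obj M \<rho> y"
    using saddle nonneg unfolding dro_obj_def by (intro SUP_upper) (auto simp: saddle_point_def)
  finally show "dro_obj M \<rho> x \<le> dro_obj M \<rho> y" .
qed

theorem theorem1:
  fixes \<mu> :: "(real ^ 'n) measure" and \<epsilon> l :: real
  assumes "prob_space \<mu>"
    and "sets \<mu> = sets borel"
    and "integrable \<mu> (\<lambda>\<xi>. norm \<xi> ^ 3)"
    and "l \<in> Lambda_set \<mu>"
    and "risk_multiplier \<mu> \<epsilon> l"
  shows "(\<forall>l_md. md_multiplier \<mu> \<epsilon> l_md \<longrightarrow>
            best_response \<mu> (nu_star \<mu> l_md (X_hat \<mu> l)) = X_hat \<mu> l \<and>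
            saddle_point (f_obj \<mu>) (chi2_ball \<mu> (l_md\<^sup>2)) UNIV
              (nu_star \<mu> l_md (X_hat \<mu> l))
              (best_response \<mu> (nu_star \<mu> l_md (X_hat \<mu> l)))) \<and>
         (\<exists>l_md. md_multiplier \<mu> \<epsilon> l_md \<and> l_md = 2 * l * sqrt \<epsilon> \<and>
            dro_solution \<mu> (l_md\<^sup>2) (X_hat \<mu> l))"
proof -
  have "finite_risk \<mu> \<noteq> {}"
    using assms(5) by (auto simp: risk_multiplier_def optimal_multiplier_def)
  then interpret finite_risk_space \<mu>
    using assms(1,2) by (simp add: finite_risk_space_def finite_risk_space_axioms_def)
  have saddle: "saddle_point (f_obj \<mu>) (chi2_ball \<mu> (k\<^sup>2)) UNIV (nu_star \<mu> k (X_hat \<mu> l)) (X_hat \<mu> l)"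
    if "md_multiplier \<mu> \<epsilon> k" for k
    using md_multiplier_minimizer(1)[OF assms(5) that] best_response_nu_star_X_hat[OF assms(5) that]
    by (rule saddle_point_of_fixed_best_response)
  have md: "md_multiplier \<mu> \<epsilon> (2 * l * sqrt \<epsilon>)"
    by (rule md_multiplier_of_risk_multiplier[OF assms(5)])
  have "dro_solution \<mu> ((2 * l * sqrt \<epsilon>)\<^sup>2) (X_hat \<mu> l)"
    using saddle_point_imp_dro_solution[OF saddle[OF md]] nu_star_nonneg[OF assms(5,4)] by simp
  with md have "\<exists>l_md. md_multiplier \<mu> \<epsilon> l_md \<and> l_md = 2 * l * sqrt \<epsilon> \<and>
      dro_solution \<mu> (l_md\<^sup>2) (X_hat \<mu> l)" by blast
  moreover have "best_response \<mu> (nu_star \<mu> k (X_hat \<mu> l)) = X_hat \<mu> l \<and>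
      saddle_point (f_obj \<mu>) (chi2_ball \<mu> (k\<^sup>2)) UNIV
        (nu_star \<mu> k (X_hat \<mu> l)) (best_response \<mu> (nu_star \<mu> k (X_hat \<mu> l)))"
    if "md_multiplier \<mu> \<epsilon> k" for k
    unfolding best_response_nu_star_X_hat[OF assms(5) that] using saddle[OF that] by blast
  ultimately show ?thesis by blast
qed

end
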